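(* For every positive integer $n$, define the quantity $\Lambda_n$ by the following equation: $$1 + \frac{1}{2} + \frac{1}{3} + \cdots + \frac{1}{n} =: \frac{1}{2}\ln(2m) + \gamma + \frac{1}{12m + \Lambda_n}.$$ Then $$\Lambda_n = \frac{6}{5} - \frac{19}{175m} + \frac{13}{250m^2} - \frac{\delta_n}{m^3},$$ where $0 < \delta_n < \frac{187969}{4042500}$. The constants in the expansion of $\Lambda_n$ all are the best possible.
   Context: Here $m := \frac{1}{2}n(n+1)$, where $n$ is a positive integer; $\gamma = 0.57721\cdots$ is Euler's constant, and $\ln$ is the natural logarithm. *)

theory Defs
  imports "HOL-Analysis.Harmonic_Numbers" "HOL-Library.Landau_Symbols"
begin

definition tri :: "nat \<Rightarrow> real" where
  "tri n = 1 / 2 * real n * (real n + 1)"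

text \<open>
  The first conjunct rules out the convention \<open>1 / 0 = 0\<close>. That a (unique) solution exists
  for \<open>n \<ge> 1\<close> is not built in; it is part of what has to be proved about \<open>Lam\<close>.
\<close>

definition Lam_equation :: "nat \<Rightarrow> real \<Rightarrow> bool" where
  "Lam_equation n L \<longleftrightarrow>
     12 * tri n + L \<noteq> 0 \<and>
     harm n = 1 / 2 * ln (2 * tri n) + euler_mascheroni + 1 / (12 * tri n + L)"

definition Lam :: "nat \<Rightarrow> real" where
  "Lam n = (THE L. Lam_equation n L)"

text \<open>
  A constant in an estimate is best possible if the estimate holds with it and with no
  smaller one.
\<close>

definition best_possible :: "(real \<Rightarrow> bool) \<Rightarrow> real \<Rightarrow> bool" where
  "best_possible P c \<longleftrightarrow> P c \<and> (\<forall>c'. P c' \<longrightarrow> c \<le> c')"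

end

theory Submission
  imports Defs "HOL-Real_Asymp.Real_Asymp"
begin

text \<open>
  The error \<open>R n = harm n - ln (2 * tri n) / 2 - euler_mascheroni\<close> tends to 0 and, with \<open>x = n + 1\<close>,
  satisfies \<open>R n - R (n + 1) = artanh (1 / x) - 1 / x\<close>, which partial sums of the power series of
  artanh bound from both sides. A rational function \<open>f\<close> with limit 0 is therefore an upper (lower)
  bound of \<open>R\<close> as soon as \<open>f n - f (n + 1)\<close> lies above (below) such a partial sum. For
  \<open>f n = 1 / (12 m + 6 / 5 - 19 / (175 m) + 13 / (250 m\<^sup>2) - c / m\<^sup>3 + d / m\<^sup>4)\<close> this yields the two bounds
  on \<open>\<delta>\<close> (with \<open>d = 0\<close> and \<open>c = 187969 / 4042500\<close> or \<open>c = 0\<close>), and with \<open>d = 1\<close> also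
  \<open>\<delta> n > 187969 / 4042500 - 1 / m\<close>. So \<open>\<delta>\<close> converges to \<open>187969 / 4042500\<close>, and every constant is
  the limit of a suitable expression in \<open>Lam n\<close>.
\<close>

section \<open>Error of the logarithmic approximation and the artanh series\<close>

definition Lam_approx :: "real \<Rightarrow> real \<Rightarrow> real \<Rightarrow> real" where
  "Lam_approx c d m = 6 / 5 - 19 / (175 * m) + 13 / (250 * m ^ 2) - c / m ^ 3 + d / m ^ 4"

definition harm_error :: "nat \<Rightarrow> real" where
  "harm_error n = harm n - 1 / 2 * ln (2 * tri n) - euler_mascheroni"

text \<open>From \<open>Suc n\<close> on the sequence decreases to its limit 0, so it is nonnegative
  there; the one strict step kept back, from \<open>n\<close> to \<open>Suc n\<close>, makes
  \<open>g n\<close> positive.\<close>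

lemma pos_if_decreasing_to_0:
  fixes g :: "nat \<Rightarrow> real"
  assumes "g \<longlonglongrightarrow> 0" and less: "\<And>n. n \<ge> N \<Longrightarrow> g (Suc n) < g n" and "n \<ge> N"
  shows "g n > 0"
proof -
  have "decseq (\<lambda>k. g (Suc n + k))"
    using less \<open>n \<ge> N\<close> by (intro decseq_SucI) (simp add: less_imp_le)
  moreover have "(\<lambda>k. g (Suc n + k)) \<longlonglongrightarrow> 0"
    using LIMSEQ_ignore_initial_segment[OF assms(1), of "Suc n"] by (simp add: add.commute)
  ultimately have "g (Suc n + 0) \<ge> 0"
    by (rule decseq_ge)
  with less[OF \<open>n \<ge> N\<close>] show ?thesis by simp
qed

lemma harm_error_eq:
  assumes "n > 0"
  shows "harm_error n = harm n - (ln (real n) + ln (real n + 1)) / 2 - euler_mascheroni"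
proof -
  have "2 * tri n = real n * (real n + 1)" by (simp add: tri_def)
  then show ?thesis using assms by (simp add: harm_error_def ln_mult)
qed

lemma harm_error_LIMSEQ: "harm_error \<longlonglongrightarrow> 0"
proof -
  \<comment> \<open>Half of this difference is what replacing \<open>ln n\<close> by the mean of
    \<open>ln n\<close> and \<open>ln (n + 1)\<close> adds, so the limit \<gamma> is
    unaffected.\<close>
  have "(\<lambda>n. ln (real n + 1) - ln (real n)) \<longlonglongrightarrow> 0"
    by real_asymp
  then have "(\<lambda>n. (harm n - ln (real n)) - 1 / 2 * (ln (real n + 1) - ln (real n)) - euler_mascheroni)
      \<longlonglongrightarrow> euler_mascheroni - 1 / 2 * 0 - (euler_mascheroni :: real)"
    by (intro tendsto_intros euler_mascheroni_LIMSEQ)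
  moreover have "\<forall>\<^sub>F n in sequentially.
      (harm n - ln (real n)) - 1 / 2 * (ln (real n + 1) - ln (real n)) - euler_mascheroni = harm_error n"
    using eventually_gt_at_top[of 0]
    by eventually_elim (simp add: harm_error_eq field_simps)
  ultimately show ?thesis
    by (auto intro: Lim_transform_eventually)
qed

text \<open>The difference is \<open>artanh (1 / x) - 1 / x\<close>. \<open>S\<close> collects the
  series from its cubic term on, and the width of the interval majorises the tail after
  \<open>K\<close> by a geometric series with ratio \<open>1 / x ^ 2\<close>.\<close>

lemma harm_error_diff_bounds:
  fixes n K :: nat
  assumes n: "n \<ge> 1"
  defines "x \<equiv> real n + 1"
  defines "S \<equiv> \<Sum>k=1..K. 1 / (real (2 * k + 1) * x ^ (2 * k + 1))"
  shows "harm_error n - harm_error (Suc n) \<in> {S..S + 1 / (real (2 * K + 3) * x ^ (2 * K + 1) * (x\<^sup>2 - 1))}"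
proof -
  have x: "x \<ge> 2" using n by (simp add: x_def)
  \<comment> \<open>Chosen so that \<open>ln z = 2 * artanh (1 / x)\<close>; in terms of
    \<open>n\<close> it is \<open>(n + 2) / n\<close>.\<close>
  define z where "z = (x + 1) / (x - 1)"
  have z: "z > 1" "(z - 1) / (z + 1) = 1 / x"
    using x by (simp_all add: z_def field_simps)
  have "harm_error n - harm_error (Suc n) = 1 / 2 * ln z - 1 / x"
    using n by (simp add: harm_error_eq harm_Suc z_def x_def ln_div field_simps)
  \<comment> \<open>Half of the term for \<open>k = 0\<close> is the \<open>1 / x\<close> subtracted
    above, which is why \<open>S\<close> starts at \<open>k = 1\<close>.\<close>
  moreover have "(\<Sum>k<K + 1. 2 * (1 / x) ^ (2 * k + 1) / real (2 * k + 1)) = 2 * (1 / x + S)"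
  proof -
    have shift: "(\<Sum>k<K + 1. f k) = f 0 + (\<Sum>k=1..K. f k)" for f :: "nat \<Rightarrow> real"
      by (simp add: sum.lessThan_Suc_shift sum.atLeast1_atMost_eq del: sum.lessThan_Suc)
    have "(\<Sum>k<K + 1. 2 * (1 / x) ^ (2 * k + 1) / real (2 * k + 1)) =
        2 / x + (\<Sum>k=1..K. 2 * (1 / x) ^ (2 * k + 1) / real (2 * k + 1))"
      unfolding shift by simp
    also have "\<dots> = 2 * (1 / x + S)"
      by (simp add: S_def sum_distrib_left power_divide field_simps)
    finally show ?thesis .
  qed
  moreover have "(1 / x) ^ (2 * (K + 1) + 1) / (1 - (1 / x)\<^sup>2) / real (2 * (K + 1) + 1) =
      1 / (real (2 * K + 3) * x ^ (2 * K + 1) * (x\<^sup>2 - 1))"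
  proof -
    have "x\<^sup>2 > 1" using power_strict_mono[of 1 x 2] x by simp
    then have x_power: "x ^ (2 * (K + 1) + 1) * (1 - (1 / x)\<^sup>2) = x ^ (2 * K + 1) * (x\<^sup>2 - 1)"
      using x by (simp add: field_simps power2_eq_square)
    have frac: "(1 / x) ^ N / D / c = 1 / (c * (x ^ N * D))" for N and D c :: real
      by (simp add: power_one_over mult_ac)
    show ?thesis
      unfolding frac x_power mult.assoc by (simp add: numeral_eq_Suc)
  qed
  ultimately show ?thesis
    using ln_approx_bounds[OF z(1), of "K + 1"] unfolding z(2) by simp
qed

section \<open>Rational inequalities for differences of the comparison functions\<close>

lemma divide_less_divideI:
  fixes a b c d :: real
  assumes "a * d < c * b" "b > 0" "d > 0"
  shows "a / b < c / d"
  using assms by (simp add: field_simps)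

text \<open>Splitting off one factor \<open>x\<close> leaves a function of \<open>x ^ 2\<close>, the
  form in which the odd series is compared below.\<close>

lemma inverse_odd_power_eq:
  fixes x :: real
  assumes "x \<noteq> 0"
  shows "1 / (c * x ^ (2 * k + 1)) = x / (c * (x\<^sup>2) ^ (k + 1))"
proof -
  have "(x\<^sup>2) ^ (k + 1) = x * x ^ (2 * k + 1)"
    by (simp add: power2_eq_square power_mult_distrib mult_2 power_add)
  then show ?thesis using assms by simp
qed

text \<open>
  The next three inequalities are rational in \<open>x\<close>; the difference on the left is odd in \<open>x\<close>.
  Up to a factor \<open>x\<close> they are thus rational in \<open>v = x\<^sup>2 - 4 \<ge> 0\<close>, and after clearing denominators
  all coefficients of the resulting polynomial in \<open>v\<close> are positive.
\<close>

lemma approx_diff_gt: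
  fixes x :: real
  assumes x: "x \<ge> 2"
  defines "a \<equiv> x * (x - 1) / 2" and "b \<equiv> x * (x + 1) / 2"
  shows "(\<Sum>k=1..4. 1 / (real (2 * k + 1) * x ^ (2 * k + 1))) + 1 / (11 * x ^ 9 * (x\<^sup>2 - 1))
    < 1 / (12 * a + Lam_approx (187969 / 4042500) 0 a) - 1 / (12 * b + Lam_approx (187969 / 4042500) 0 b)"
proof -
  define v where "v = x\<^sup>2 - 4"
  define q :: "real \<Rightarrow> real" where "q = (\<lambda>m. -187969 + 210210 * m - 438900 * m ^ 2 +
      4851000 * m ^ 3 + 48510000 * m ^ 4)"
  \<comment> \<open>Replacing \<open>x\<close> by \<open>-x\<close> exchanges \<open>a\<close> and
    \<open>b\<close>. Hence \<open>q a * q b\<close> is even in \<open>x\<close> and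
    \<open>a ^ 3 * q b - b ^ 3 * q a\<close> is odd; \<open>Q\<close> and \<open>M\<close> are the
    resulting polynomials in \<open>v\<close>.\<close>
  define M :: "real \<Rightarrow> real" where "M = (\<lambda>v. 5310394458022500 + v * (9280685217890625 + v *
      (6735066774108750 + v * (2596623133190625 + v * (560839117781250 + v * (64345862109375 + v *
      3064088671875))))))"
  define Q :: "real \<Rightarrow> real" where "Q = (\<lambda>v. 214783520439414301 + v * (493931479312560135 +
      v * (495114706260797700 + v * (282719361566824875 + v * (100611415338328125 + v * (22852249958278125 + v
      * (3235379983171875 + v * (261060354843750 + v * 9192266015625))))))))"
  have xv: "x\<^sup>2 = v + 4" and v: "v \<ge> 0"
    using power_mono[OF x, of 2] by (simp_all add: v_def)
  have ab: "a \<ge> 1" "b \<ge> 1"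
    using mult_mono[of 2 x 1 "x - 1"] mult_mono[of 2 x 1 "x + 1"] x by (auto simp: a_def b_def)
  have q_pos: "q m > 0" if m: "m \<ge> 1" for m
  proof -
    \<comment> \<open>Expansion about \<open>m = 1\<close>: all coefficients are positive, although
      those of \<open>q\<close> itself are not.\<close>
    have "q m = 52944341 + (m - 1) * (207925410 + (m - 1) * (305174100 + (m - 1) * (198891000 + (m - 1) * 48510000)))"
      by (simp add: q_def) algebra
    also have "\<dots> > 0"
      using m by (intro add_pos_nonneg mult_nonneg_nonneg add_nonneg_nonneg) auto
    finally show ?thesis .
  qed
  have F: "12 * m + Lam_approx (187969 / 4042500) 0 m = q m / (4042500 * m ^ 3)" if "m \<ge> 1" for m
    using that by (simp add: q_def Lam_approx_def field_simps eval_nat_numeral)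
  have Q_pos: "Q v > 0"
    unfolding Q_def using v by (intro add_pos_nonneg mult_nonneg_nonneg add_nonneg_nonneg) auto
  have M_eq: "4042500 * (a ^ 3 * q b - b ^ 3 * q a) = x * M v"
    unfolding q_def a_def b_def M_def v_def by (simp add: field_simps eval_nat_numeral)
  have Q_eq: "q a * q b = Q v"
    unfolding q_def a_def b_def Q_def v_def by (simp add: field_simps eval_nat_numeral)
  have diff: "1 / (12 * a + Lam_approx (187969 / 4042500) 0 a) - 1 / (12 * b + Lam_approx (187969 / 4042500) 0 b)
      = x * (M v / Q v)"
  proof -
    have "1 / (12 * a + Lam_approx (187969 / 4042500) 0 a) - 1 / (12 * b + Lam_approx (187969 / 4042500) 0 b)
        = 4042500 * (a ^ 3 * q b - b ^ 3 * q a) / (q a * q b)"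
      unfolding F[OF ab(1)] F[OF ab(2)] using q_pos[OF ab(1)] q_pos[OF ab(2)]
      by (simp add: field_simps)
    also have "\<dots> = x * M v / Q v"
      unfolding M_eq Q_eq ..
    finally show ?thesis by simp
  qed
  have odd: "1 / (c * x ^ (2 * k + 1)) = x / (c * (v + 4) ^ (k + 1))" for k and c :: real
    using inverse_odd_power_eq[of x c k] x by (simp add: xv)
  have tail: "1 / (11 * x ^ 9 * (x\<^sup>2 - 1)) = x / (11 * (v + 4) ^ 5 * (v + 3))"
    \<comment> \<open>The factor \<open>x ^ 2 - 1 = v + 3\<close> is absorbed into the constant
      \<open>c\<close>.\<close>
    using odd[of "11 * (v + 3)" 4] by (simp add: xv algebra_simps)
  have series: "(\<Sum>k=1..4. 1 / (real (2 * k + 1) * x ^ (2 * k + 1))) + 1 / (11 * x ^ 9 * (x\<^sup>2 - 1))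
      = x * ((((v + 4) ^ 3 / 3 + (v + 4) ^ 2 / 5 + (v + 4) / 7 + 1 / 9) * (v + 3) + 1 / 11) / ((v + 4) ^ 5 * (v + 3)))"
  proof -
    obtain w where w: "v + 4 = w" "v + 3 = w - 1" "w > 1"
      using v by auto
    show ?thesis
      unfolding odd tail w(1,2) using w(3) by (simp add: field_simps numeral_eq_Suc)
  qed
  \<comment> \<open>The difference of the cross products, multiplied by 3465, the least common
    multiple of 3, 5, 7, 9, 11. Both products have degree 12 in \<open>v\<close>; the degrees 8 to
    12 cancel because the five coefficients 12, 6/5, -19/175, 13/250 and -187969/4042500 match the
    series to that order.\<close>
  have "0 < 159889197534088131366 + v * (283459356424081976600 + v * (215020637342592525312 + v *
      (90479926836141968202 + v * (22812962354844207315 + v * (3446756624310840225 + v * (288968008399599375 +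
      v * 10371044389860000))))))"
    using v by (intro add_pos_nonneg mult_nonneg_nonneg add_nonneg_nonneg) auto
  also have "\<dots> = 3465 * (M v * ((v + 4) ^ 5 * (v + 3)) - ((((v + 4) ^ 3 / 3 + (v + 4) ^ 2 / 5 + (v + 4)
      / 7 + 1 / 9) * (v + 3) + 1 / 11) * Q v))"
    unfolding M_def Q_def by (simp add: field_simps eval_nat_numeral)
  finally have "(((v + 4) ^ 3 / 3 + (v + 4) ^ 2 / 5 + (v + 4) / 7 + 1 / 9) * (v + 3) + 1 / 11) * Q v
      < M v * ((v + 4) ^ 5 * (v + 3))"
    by simp
  then have "(((v + 4) ^ 3 / 3 + (v + 4) ^ 2 / 5 + (v + 4) / 7 + 1 / 9) * (v + 3) + 1 / 11) / ((v + 4) ^ 5 * (v + 3))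
      < M v / Q v"
    by (rule divide_less_divideI) (use Q_pos v in auto)
  then show ?thesis
    unfolding diff series using x by (intro mult_strict_left_mono) auto
qed

lemma approx_diff_lt:
  fixes x :: real
  assumes x: "x \<ge> 2"
  defines "a \<equiv> x * (x - 1) / 2" and "b \<equiv> x * (x + 1) / 2"
  shows "1 / (12 * a + Lam_approx 0 0 a) - 1 / (12 * b + Lam_approx 0 0 b)
    < (\<Sum>k=1..4. 1 / (real (2 * k + 1) * x ^ (2 * k + 1)))"
proof -
  define v where "v = x\<^sup>2 - 4"
  define q :: "real \<Rightarrow> real" where "q = (\<lambda>m. 91 - 190 * m + 2100 * m ^ 2 + 21000 * m ^ 3)"
  define M :: "real \<Rightarrow> real" where "M = (\<lambda>v. 331110500 + v * (386297625 + v * (167755000 +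
      v * (32156250 + v * 2296875))))"
  define Q :: "real \<Rightarrow> real" where "Q = (\<lambda>v. 13465268421 + v * (23040278835 + v *
      (16378600450 + v * (6188172375 + v * (1310373750 + v * (147459375 + v * 6890625))))))"
  have xv: "x\<^sup>2 = v + 4" and v: "v \<ge> 0"
    using power_mono[OF x, of 2] by (simp_all add: v_def)
  have ab: "a \<ge> 1" "b \<ge> 1"
    using mult_mono[of 2 x 1 "x - 1"] mult_mono[of 2 x 1 "x + 1"] x by (auto simp: a_def b_def)
  have q_pos: "q m > 0" if m: "m \<ge> 1" for m
  proof -
    have "q m = 23001 + (m - 1) * (67010 + (m - 1) * (65100 + (m - 1) * 21000))"
      by (simp add: q_def) algebra
    also have "\<dots> > 0"
      using m by (intro add_pos_nonneg mult_nonneg_nonneg add_nonneg_nonneg) auto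
    finally show ?thesis .
  qed
  have F: "12 * m + Lam_approx 0 0 m = q m / (1750 * m ^ 2)" if "m \<ge> 1" for m
    using that by (simp add: q_def Lam_approx_def field_simps eval_nat_numeral)
  have Q_pos: "Q v > 0"
    unfolding Q_def using v by (intro add_pos_nonneg mult_nonneg_nonneg add_nonneg_nonneg) auto
  have M_eq: "1750 * (a ^ 2 * q b - b ^ 2 * q a) = x * M v"
    unfolding q_def a_def b_def M_def v_def by (simp add: field_simps eval_nat_numeral)
  have Q_eq: "q a * q b = Q v"
    unfolding q_def a_def b_def Q_def v_def by (simp add: field_simps eval_nat_numeral)
  have diff: "1 / (12 * a + Lam_approx 0 0 a) - 1 / (12 * b + Lam_approx 0 0 b)
      = x * (M v / Q v)"
  proof -
    have "1 / (12 * a + Lam_approx 0 0 a) - 1 / (12 * b + Lam_approx 0 0 b)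
        = 1750 * (a ^ 2 * q b - b ^ 2 * q a) / (q a * q b)"
      unfolding F[OF ab(1)] F[OF ab(2)] using q_pos[OF ab(1)] q_pos[OF ab(2)]
      by (simp add: field_simps)
    also have "\<dots> = x * M v / Q v"
      unfolding M_eq Q_eq ..
    finally show ?thesis by simp
  qed
  have odd: "1 / (c * x ^ (2 * k + 1)) = x / (c * (v + 4) ^ (k + 1))" for k and c :: real
    using inverse_odd_power_eq[of x c k] x by (simp add: xv)
  have series: "(\<Sum>k=1..4. 1 / (real (2 * k + 1) * x ^ (2 * k + 1)))
      = x * (((v + 4) ^ 3 / 3 + (v + 4) ^ 2 / 5 + (v + 4) / 7 + 1 / 9) / ((v + 4) ^ 5))"
  proof -
    obtain w where w: "v + 4 = w" "w > 0"
      using v by auto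
    show ?thesis
      unfolding odd w(1) using w(2) by (simp add: field_simps numeral_eq_Suc)
  qed
  \<comment> \<open>Again the difference of the cross products, with 315 clearing 3, 5, 7, 9. Only
    four coefficients are matched here, so the degrees 6 to 9 cancel; the sign of what is left
    reflects that \<open>c = 0\<close> lies below the limiting value 187969/4042500.\<close>
  have "0 < 151624188003 + v * (158404471374 + v * (63759904148 + v * (12086772585 + v * (1027323150 + v * 26958750))))"
    using v by (intro add_pos_nonneg mult_nonneg_nonneg add_nonneg_nonneg) auto
  also have "\<dots> = 315 * (((v + 4) ^ 3 / 3 + (v + 4) ^ 2 / 5 + (v + 4) / 7 + 1 / 9) * Q v - (M v * ((v + 4) ^ 5)))"
    unfolding M_def Q_def by (simp add: field_simps eval_nat_numeral)
  finally have "M v * ((v + 4) ^ 5)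
      < ((v + 4) ^ 3 / 3 + (v + 4) ^ 2 / 5 + (v + 4) / 7 + 1 / 9) * Q v"
    by simp
  then have "M v / Q v
      < ((v + 4) ^ 3 / 3 + (v + 4) ^ 2 / 5 + (v + 4) / 7 + 1 / 9) / ((v + 4) ^ 5)"
    by (rule divide_less_divideI) (use Q_pos v in auto)
  then show ?thesis
    unfolding diff series using x by (intro mult_strict_left_mono) auto
qed

lemma approx_diff_lt_refined:
  fixes x :: real
  assumes x: "x \<ge> 2"
  defines "a \<equiv> x * (x - 1) / 2" and "b \<equiv> x * (x + 1) / 2"
  shows "1 / (12 * a + Lam_approx (187969 / 4042500) 1 a) - 1 / (12 * b + Lam_approx (187969 / 4042500) 1 b)
    < (\<Sum>k=1..5. 1 / (real (2 * k + 1) * x ^ (2 * k + 1)))"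
proof -
  define v where "v = x\<^sup>2 - 4"
  define q :: "real \<Rightarrow> real" where "q = (\<lambda>m. 4042500 - 187969 * m + 210210 * m ^ 2 - 438900
      * m ^ 3 + 4851000 * m ^ 4 + 48510000 * m ^ 5)"
  define M :: "real \<Rightarrow> real" where "M = (\<lambda>v. 61110044496270000 + v * (146710701520845000 +
      v * (150671105310061875 + v * (87552946622439375 + v * (31641498119818125 + v * (7294647302971875 + v *
      (1048029216609375 + v * (85794482812500 + v * 3064088671875))))))))"
  define Q :: "real \<Rightarrow> real" where "Q = (\<lambda>v. 2775118098996051612 + v * (7635983019794541727
      + v * (9696694690784757646 + v * (7368513960623042535 + v * (3682967788934759325 + v *
      (1261275293853209250 + v * (299401724844337500 + v * (48632634098606250 + v * (5173109659265625 + v *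
      (325406216953125 + v * 9192266015625))))))))))"
  have xv: "x\<^sup>2 = v + 4" and v: "v \<ge> 0"
    using power_mono[OF x, of 2] by (simp_all add: v_def)
  have ab: "a \<ge> 1" "b \<ge> 1"
    using mult_mono[of 2 x 1 "x - 1"] mult_mono[of 2 x 1 "x + 1"] x by (auto simp: a_def b_def)
  have q_pos: "q m > 0" if m: "m \<ge> 1" for m
  proof -
    have "q m = 56986841 + (m - 1) * (260869751 + (m - 1) * (513099510 + (m - 1) * (504065100 + (m - 1) *
        (247401000 + (m - 1) * 48510000))))"
      by (simp add: q_def) algebra
    also have "\<dots> > 0"
      using m by (intro add_pos_nonneg mult_nonneg_nonneg add_nonneg_nonneg) auto
    finally show ?thesis .
  qed
  have F: "12 * m + Lam_approx (187969 / 4042500) 1 m = q m / (4042500 * m ^ 4)" if "m \<ge> 1" for m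
    using that by (simp add: q_def Lam_approx_def field_simps eval_nat_numeral)
  have Q_pos: "Q v > 0"
    unfolding Q_def using v by (intro add_pos_nonneg mult_nonneg_nonneg add_nonneg_nonneg) auto
  \<comment> \<open>The factor 4 removes the denominators caused by
    \<open>a * b = x ^ 2 * (x ^ 2 - 1) / 4\<close>.\<close>
  have M_eq: "4 * (4042500 * (a ^ 4 * q b - b ^ 4 * q a)) = x * M v"
    unfolding q_def a_def b_def M_def v_def by (simp add: field_simps eval_nat_numeral)
  have Q_eq: "4 * (q a * q b) = Q v"
    unfolding q_def a_def b_def Q_def v_def by (simp add: field_simps eval_nat_numeral)
  have diff: "1 / (12 * a + Lam_approx (187969 / 4042500) 1 a) - 1 / (12 * b + Lam_approx (187969 / 4042500) 1 b)
      = x * (M v / Q v)"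
  proof -
    have "1 / (12 * a + Lam_approx (187969 / 4042500) 1 a) - 1 / (12 * b + Lam_approx (187969 / 4042500) 1 b)
        = 4042500 * (a ^ 4 * q b - b ^ 4 * q a) / (q a * q b)"
      unfolding F[OF ab(1)] F[OF ab(2)] using q_pos[OF ab(1)] q_pos[OF ab(2)]
      by (simp add: field_simps)
    also have "\<dots> = 4 * (4042500 * (a ^ 4 * q b - b ^ 4 * q a)) / (4 * (q a * q b))"
      by (rule mult_divide_mult_cancel_left[symmetric]) simp
    also have "\<dots> = x * M v / Q v"
      unfolding M_eq Q_eq ..
    finally show ?thesis by simp
  qed
  have odd: "1 / (c * x ^ (2 * k + 1)) = x / (c * (v + 4) ^ (k + 1))" for k and c :: real
    using inverse_odd_power_eq[of x c k] x by (simp add: xv)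
  have series: "(\<Sum>k=1..5. 1 / (real (2 * k + 1) * x ^ (2 * k + 1)))
      = x * (((v + 4) ^ 4 / 3 + (v + 4) ^ 3 / 5 + (v + 4) ^ 2 / 7 + (v + 4) / 9 + 1 / 11) / ((v + 4) ^ 6))"
  proof -
    obtain w where w: "v + 4 = w" "w > 0"
      using v by auto
    show ?thesis
      unfolding odd w(1) using w(2) by (simp add: field_simps numeral_eq_Suc)
  qed
  \<comment> \<open>Five degrees, 10 to 14, cancel as for \<open>d = 0\<close>. The value
    \<open>d = 1\<close> affects only lower degrees and is large enough to reverse the
    inequality.\<close>
  have "0 < 103442874935970373438884 + v * (212855184589446543608557 + v * (194272664404008096216317 + v *
      (103177456796100760921672 + v * (35122165239162563798907 + v * (7942275831703693282803 + v *
      (1192297046647024559010 + v * (114487541338474839150 + v * (6374469895201051875 + v *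
      156606467783968125))))))))"
    using v by (intro add_pos_nonneg mult_nonneg_nonneg add_nonneg_nonneg) auto
  also have "\<dots> = 3465 * (((v + 4) ^ 4 / 3 + (v + 4) ^ 3 / 5 + (v + 4) ^ 2 / 7 + (v + 4) / 9 + 1 / 11) *
      Q v - (M v * ((v + 4) ^ 6)))"
    unfolding M_def Q_def by (simp add: field_simps eval_nat_numeral)
  finally have "M v * ((v + 4) ^ 6)
      < ((v + 4) ^ 4 / 3 + (v + 4) ^ 3 / 5 + (v + 4) ^ 2 / 7 + (v + 4) / 9 + 1 / 11) * Q v"
    by simp
  then have "M v / Q v
      < ((v + 4) ^ 4 / 3 + (v + 4) ^ 3 / 5 + (v + 4) ^ 2 / 7 + (v + 4) / 9 + 1 / 11) / ((v + 4) ^ 6)"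
    by (rule divide_less_divideI) (use Q_pos v in auto)
  then show ?thesis
    unfolding diff series using x by (intro mult_strict_left_mono) auto
qed

section \<open>Bounds on the error term and on \<open>Lam\<close>\<close>

lemma tri_ge: "tri n \<ge> real n"
  by (cases n) (auto simp: tri_def field_simps)

lemma tri_ge_1: "n \<ge> 1 \<Longrightarrow> tri n \<ge> 1"
  using tri_ge[of n] by linarith

lemma inverse_tri_LIMSEQ: "(\<lambda>n. 1 / tri n) \<longlonglongrightarrow> 0"
  unfolding tri_def by real_asymp

lemma approx_LIMSEQ: "(\<lambda>n. 1 / (12 * tri n + Lam_approx c d (tri n))) \<longlonglongrightarrow> 0"
  unfolding Lam_approx_def tri_def by real_asymp

text \<open>Centring at \<open>x = n + 1\<close> turns consecutive triangular numbers into the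
  \<open>a\<close> and \<open>b\<close> of the rational inequalities.\<close>

lemma tri_via_Suc:
  fixes n :: nat
  defines "x \<equiv> real n + 1"
  shows "tri n = x * (x - 1) / 2" "tri (Suc n) = x * (x + 1) / 2"
  by (simp_all add: x_def tri_def algebra_simps)

lemma harm_error_less:
  assumes "n \<ge> 1"
  shows "harm_error n < 1 / (12 * tri n + Lam_approx (187969 / 4042500) 0 (tri n))"
proof -
  define f where "f = (\<lambda>n. 1 / (12 * tri n + Lam_approx (187969 / 4042500) 0 (tri n)))"
  have "f n - harm_error n > 0"
  proof (rule pos_if_decreasing_to_0[of "\<lambda>n. f n - harm_error n" 1])
    show "(\<lambda>n. f n - harm_error n) \<longlonglongrightarrow> 0"
      using tendsto_diff[OF approx_LIMSEQ harm_error_LIMSEQ] by (simp add: f_def)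
    show "f (Suc k) - harm_error (Suc k) < f k - harm_error k" if "k \<ge> 1" for k
    proof -
      have x: "real k + 1 \<ge> 2" using that by simp
      show ?thesis
        \<comment> \<open>The decrement of \<open>f\<close> must exceed the upper end of the
          interval; for \<open>K = 4\<close> the tail is
          \<open>1 / (11 * x ^ 9 * (x\<^sup>2 - 1))\<close>.\<close>
        using approx_diff_gt[OF x] harm_error_diff_bounds[OF that, of 4]
        unfolding f_def tri_via_Suc[of k] by simp
    qed
  qed fact
  then show ?thesis by (simp add: f_def)
qed

lemma harm_error_greater:
  assumes "n \<ge> 1"
  shows "harm_error n > 1 / (12 * tri n + Lam_approx 0 0 (tri n))"
proof -
  define f where "f = (\<lambda>n. 1 / (12 * tri n + Lam_approx 0 0 (tri n)))"
  have "harm_error n - f n > 0"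
  proof (rule pos_if_decreasing_to_0[of "\<lambda>n. harm_error n - f n" 1])
    show "(\<lambda>n. harm_error n - f n) \<longlonglongrightarrow> 0"
      using tendsto_diff[OF harm_error_LIMSEQ approx_LIMSEQ] by (simp add: f_def)
    show "harm_error (Suc k) - f (Suc k) < harm_error k - f k" if "k \<ge> 1" for k
    proof -
      have x: "real k + 1 \<ge> 2" using that by simp
      show ?thesis
        \<comment> \<open>In this direction the lower end of the interval, the bare partial sum,
          suffices.\<close>
        using approx_diff_lt[OF x] harm_error_diff_bounds[OF that, of 4]
        unfolding f_def tri_via_Suc[of k] atLeastAtMost_iff by linarith
    qed
  qed fact
  then show ?thesis by (simp add: f_def)
qed

lemma harm_error_greater_refined:
  assumes "n \<ge> 1"
  shows "harm_error n > 1 / (12 * tri n + Lam_approx (187969 / 4042500) 1 (tri n))"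
proof -
  define f where "f = (\<lambda>n. 1 / (12 * tri n + Lam_approx (187969 / 4042500) 1 (tri n)))"
  have "harm_error n - f n > 0"
  proof (rule pos_if_decreasing_to_0[of "\<lambda>n. harm_error n - f n" 1])
    show "(\<lambda>n. harm_error n - f n) \<longlonglongrightarrow> 0"
      using tendsto_diff[OF harm_error_LIMSEQ approx_LIMSEQ] by (simp add: f_def)
    show "harm_error (Suc k) - f (Suc k) < harm_error k - f k" if "k \<ge> 1" for k
    proof -
      have x: "real k + 1 \<ge> 2" using that by simp
      show ?thesis
        \<comment> \<open>The coefficient of \<open>1 / m ^ 3\<close> enters the decrement of
          \<open>f\<close> at order \<open>x ^ (-11)\<close>, so the partial sum has to include
          \<open>1 / (11 * x ^ 11)\<close>; hence \<open>K = 5\<close>.\<close>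
        using approx_diff_lt_refined[OF x] harm_error_diff_bounds[OF that, of 5]
        unfolding f_def tri_via_Suc[of k] atLeastAtMost_iff by linarith
    qed
  qed fact
  then show ?thesis by (simp add: f_def)
qed

text \<open>The term \<open>12 * m\<close> dominates crude bounds on the rest. Positivity allows the
  bounds on \<open>harm_error\<close> to be inverted.\<close>

lemma Lam_approx_pos:
  assumes "m \<ge> 1" "0 \<le> c" "c \<le> 1" "0 \<le> d"
  shows "12 * m + Lam_approx c d m > 0"
proof -
  have "19 / (175 * m) \<le> 19 / 175" "c / m ^ 3 \<le> 1" "13 / (250 * m ^ 2) \<ge> 0" "d / m ^ 4 \<ge> 0"
    using assms by (auto simp: divide_simps intro: order_trans[of _ 1])
  then show ?thesis
    using assms(1) unfolding Lam_approx_def by linarith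
qed

lemma harm_error_pos:
  assumes "n \<ge> 1"
  shows "harm_error n > 0"
  using harm_error_greater[OF assms] Lam_approx_pos[of "tri n" 0 0] tri_ge_1[OF assms]
  by (auto intro: less_trans[rotated])

text \<open>Since \<open>harm_error n\<close> is positive,
  \<open>harm_error n = 1 / (12 * tri n + L)\<close> can be inverted; this gives existence and
  uniqueness of the solution together.\<close>

lemma Lam_equation_iff:
  assumes "n \<ge> 1"
  shows "Lam_equation n L \<longleftrightarrow> L = 1 / harm_error n - 12 * tri n"
proof -
  have "Lam_equation n L \<longleftrightarrow> 12 * tri n + L \<noteq> 0 \<and> harm_error n = 1 / (12 * tri n + L)"
    by (auto simp: Lam_equation_def harm_error_def)
  also have "\<dots> \<longleftrightarrow> 12 * tri n + L = 1 / harm_error n"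
    using harm_error_pos[OF assms] by auto
  finally show ?thesis by auto
qed

lemma Lam_eq: "n \<ge> 1 \<Longrightarrow> Lam n = 1 / harm_error n - 12 * tri n"
  by (simp add: Lam_def Lam_equation_iff)

text \<open>Taking reciprocals reverses the bounds: the upper bound on \<open>harm_error n\<close>
  gives the lower bound on \<open>Lam n\<close>, the two lower bounds give the upper ones.\<close>

lemma Lam_bounds:
  assumes n: "n \<ge> 1"
  shows "Lam n > Lam_approx (187969 / 4042500) 0 (tri n)"
    and "Lam n < Lam_approx 0 0 (tri n)"
    and "Lam n < Lam_approx (187969 / 4042500) 1 (tri n)"
  using harm_error_pos[OF n] harm_error_less[OF n] harm_error_greater[OF n] harm_error_greater_refined[OF n]
    Lam_approx_pos[OF tri_ge_1[OF n], of "187969 / 4042500" 0] Lam_approx_pos[OF tri_ge_1[OF n], of 0 0]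
    Lam_approx_pos[OF tri_ge_1[OF n], of "187969 / 4042500" 1]
  by (simp_all add: Lam_eq[OF n] field_simps)

section \<open>Criteria for sharp constants and for uniqueness of coefficients\<close>

text \<open>\<open>X n\<close> arises by solving the estimate at \<open>n\<close> for its constant.
  Every admissible constant exceeds all \<open>X n\<close>, hence is at least their limit.\<close>

lemma best_possibleI:
  assumes "P c" and "X \<longlonglongrightarrow> c" and "\<And>c' n. P c' \<Longrightarrow> n \<ge> 1 \<Longrightarrow> X n < c'"
  shows "best_possible P c"
  unfolding best_possible_def
proof (intro conjI allI impI)
  fix c' assume "P c'"
  then show "c \<le> c'"
    using assms by (intro LIMSEQ_le_const2[OF assms(2)] exI[of _ 1]) (auto intro: less_imp_le)
qed fact

text \<open>The limit of the sum is \<open>a\<close>, so \<open>a = 0\<close>; dividing by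
  \<open>u n\<close>, which is eventually nonzero, lowers the order by one, and the same argument
  gives \<open>b = 0\<close> and then \<open>c = 0\<close>.\<close>

lemma expansion_coeffs_zero:
  fixes u :: "nat \<Rightarrow> real" and a b c :: real
  assumes u: "u \<longlonglongrightarrow> 0" and pos: "\<forall>\<^sub>F n in sequentially. u n > 0"
    and bigo: "(\<lambda>n. a + b * u n + c * u n ^ 2) \<in> O(\<lambda>n. u n ^ 3)"
  shows "a = 0 \<and> b = 0 \<and> c = 0"
proof -
  have step: "f \<longlonglongrightarrow> 0" if f: "f \<in> O(\<lambda>n. u n ^ Suc k)" for f :: "nat \<Rightarrow> real" and k
  proof -
    from f obtain K where "\<forall>\<^sub>F n in sequentially. norm (f n) \<le> K * norm (u n ^ Suc k)"
      by (elim landau_o.bigE)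
    moreover have "(\<lambda>n. K * norm (u n ^ Suc k)) \<longlonglongrightarrow> 0"
      using u by (intro tendsto_mult_right_zero tendsto_norm_zero tendsto_null_power) simp_all
    ultimately show ?thesis
      by (rule Lim_null_comparison)
  qed
  have cancel: "f \<in> O(\<lambda>n. u n ^ k)" if "(\<lambda>n. u n * f n) \<in> O(\<lambda>n. u n ^ Suc k)" for f k
  proof -
    have "(\<lambda>n. u n * f n) \<in> O(\<lambda>n. u n * u n ^ k)" using that by simp
    moreover have "\<forall>\<^sub>F n in sequentially. u n \<noteq> 0" using pos by eventually_elim simp
    ultimately show ?thesis by (simp add: landau_o.big.mult_cancel_left)
  qed
  have "(\<lambda>n. a + b * u n + c * u n ^ 2) \<longlonglongrightarrow> a + b * 0 + c * 0 ^ 2"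
    by (intro tendsto_intros u)
  with step[of _ 2] bigo have a: "a = 0"
    using LIMSEQ_unique by (fastforce simp: numeral_eq_Suc)
  have bigo2: "(\<lambda>n. b + c * u n) \<in> O(\<lambda>n. u n ^ 2)"
    by (rule cancel) (use a bigo in \<open>simp add: algebra_simps power2_eq_square power3_eq_cube\<close>)
  have "(\<lambda>n. b + c * u n) \<longlonglongrightarrow> b + c * 0"
    by (intro tendsto_intros u)
  with step[of _ 1] bigo2 have b: "b = 0"
    using LIMSEQ_unique by (fastforce simp: numeral_eq_Suc)
  have "(\<lambda>n. c) \<in> O(\<lambda>n. u n ^ 1)"
    by (rule cancel) (use b bigo2 in \<open>simp add: mult.commute power2_eq_square\<close>)
  with step[of "\<lambda>_. c" 0] have "c = 0"
    by (simp add: LIMSEQ_const_iff)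
  with a b show ?thesis by simp
qed

section \<open>The expansion with its remainder, sharpness of each constant, uniqueness of the
  coefficients\<close>

theorem corollary2:
  "(\<forall>n\<ge>1. (\<exists>!L. Lam_equation n L) \<and> Lam_equation n (Lam n)) \<and>
   (\<exists>\<delta> :: nat \<Rightarrow> real.
      (\<forall>n\<ge>1. Lam n = 6 / 5 - 19 / (175 * tri n) + 13 / (250 * tri n ^ 2) - \<delta> n / tri n ^ 3
             \<and> 0 < \<delta> n \<and> \<delta> n < 187969 / 4042500) \<and>
      best_possible (\<lambda>c. \<forall>n\<ge>1. \<delta> n < c) (187969 / 4042500)) \<and>
   best_possible (\<lambda>c. \<forall>n\<ge>1. Lam n < c) (6 / 5) \<and>
   best_possible (\<lambda>c. \<forall>n\<ge>1. Lam n > 6 / 5 - c / tri n) (19 / 175) \<and>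
   best_possible (\<lambda>c. \<forall>n\<ge>1. Lam n < 6 / 5 - 19 / (175 * tri n) + c / tri n ^ 2) (13 / 250) \<and>
   (\<forall>a b c :: real.
      (\<lambda>n. Lam n - (a - b / tri n + c / tri n ^ 2)) \<in> O(\<lambda>n. 1 / tri n ^ 3) \<longrightarrow>
      a = 6 / 5 \<and> b = 19 / 175 \<and> c = 13 / 250)"
proof -
  define C :: real where "C = 187969 / 4042500"
  define u where "u n = 1 / tri n" for n
  \<comment> \<open>Obtained by solving the claimed expansion for its remainder.\<close>
  define \<delta> where "\<delta> n = tri n ^ 3 * (Lam_approx 0 0 (tri n) - Lam n)" for n
  have u: "0 < u n" "u n \<le> 1" "tri n = 1 / u n" if "n \<ge> 1" for n
    using tri_ge_1[OF that] by (simp_all add: u_def)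
  have u_lim: "u \<longlonglongrightarrow> 0"
    using inverse_tri_LIMSEQ by (simp add: u_def[abs_def])
  have approx: "Lam_approx c d (tri n) =
      6 / 5 - 19 / 175 * u n + 13 / 250 * u n ^ 2 - c * u n ^ 3 + d * u n ^ 4" for c d n
    by (simp add: Lam_approx_def u_def power_divide)
  have Lam: "Lam n = 6 / 5 - 19 / 175 * u n + 13 / 250 * u n ^ 2 - \<delta> n * u n ^ 3" if "n \<ge> 1" for n
  proof -
    have "\<delta> n * u n ^ 3 = Lam_approx 0 0 (tri n) - Lam n"
      using tri_ge_1[OF that] by (simp add: \<delta>_def u_def power_divide)
    then show ?thesis by (simp add: approx)
  qed
  have \<delta>: "0 < \<delta> n" "\<delta> n < C" "C - u n < \<delta> n" if n: "n \<ge> 1" for n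
  proof -
    \<comment> \<open>The three bounds on \<open>Lam n\<close> after removal of the common terms; in
      the third, \<open>u n ^ 4\<close> is split as \<open>u n * u n ^ 3\<close>.\<close>
    have "\<delta> n * u n ^ 3 < C * u n ^ 3" "0 * u n ^ 3 < \<delta> n * u n ^ 3" "(C - u n) * u n ^ 3 < \<delta> n * u n ^ 3"
      using Lam_bounds[OF n] by (simp_all add: approx Lam[OF n] C_def algebra_simps power4_eq_xxxx power3_eq_cube)
    then show "0 < \<delta> n" "\<delta> n < C" "C - u n < \<delta> n"
      using u(1)[OF n] by (simp_all add: mult_less_cancel_right_pos zero_less_mult_iff)
  qed
  have ev: "\<forall>\<^sub>F n in sequentially. n \<ge> 1"
    by (rule eventually_ge_at_top)
  have "(\<lambda>n. C - u n) \<longlonglongrightarrow> C"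
    using tendsto_diff[OF tendsto_const u_lim] by simp
  then have \<delta>_lim: "\<delta> \<longlonglongrightarrow> C"
    using \<delta> ev by (intro tendsto_sandwich[of "\<lambda>n. C - u n" \<delta> _ "\<lambda>_. C"])
      (auto intro!: eventually_mono[OF ev] less_imp_le)
  have u_power: "u n * u n \<le> u n" "u n ^ 3 \<le> u n * u n" if "n \<ge> 1" for n
    using u[OF that] by (simp_all add: power3_eq_cube mult_left_le)

  have 1: "(\<exists>!L. Lam_equation n L) \<and> Lam_equation n (Lam n)" if "n \<ge> 1" for n
    using that by (simp add: Lam_equation_iff Lam_eq)
  have 2: "Lam n = 6 / 5 - 19 / (175 * tri n) + 13 / (250 * tri n ^ 2) - \<delta> n / tri n ^ 3
      \<and> 0 < \<delta> n \<and> \<delta> n < 187969 / 4042500" if "n \<ge> 1" for n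
    using Lam[OF that] \<delta>[OF that] by (simp add: u_def C_def power_divide)
  have 3: "best_possible (\<lambda>c. \<forall>n\<ge>1. \<delta> n < c) (187969 / 4042500)"
    using \<delta> \<delta>_lim by (intro best_possibleI[of _ _ \<delta>]) (auto simp: C_def)
  have 4: "best_possible (\<lambda>c. \<forall>n\<ge>1. Lam n < c) (6 / 5)"
  proof (rule best_possibleI[of _ _ Lam])
    have "(\<lambda>n. 6 / 5 - 19 / 175 * u n + 13 / 250 * u n ^ 2 - \<delta> n * u n ^ 3)
        \<longlonglongrightarrow> 6 / 5 - 19 / 175 * 0 + 13 / 250 * 0 ^ 2 - C * 0 ^ 3"
      by (intro tendsto_intros u_lim \<delta>_lim)
    moreover have "\<forall>\<^sub>F n in sequentially.
        6 / 5 - 19 / 175 * u n + 13 / 250 * u n ^ 2 - \<delta> n * u n ^ 3 = Lam n"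
      using ev by eventually_elim (simp add: Lam)
    ultimately show "Lam \<longlonglongrightarrow> 6 / 5"
      by (auto intro: Lim_transform_eventually)
    show "\<forall>n\<ge>1. Lam n < 6 / 5"
    proof (intro allI impI)
      fix n :: nat assume n: "n \<ge> 1"
      \<comment> \<open>Because \<open>u n ^ 2 \<le> u n\<close> and 13/250 < 19/175, the negative
        linear term outweighs the quadratic one.\<close>
      have "\<delta> n * u n ^ 3 > 0" using \<delta>[OF n] u[OF n] by simp
      then show "Lam n < 6 / 5"
        using u[OF n] u_power[OF n] unfolding Lam[OF n] power2_eq_square by linarith
    qed
  qed auto
  have 5: "best_possible (\<lambda>c. \<forall>n\<ge>1. Lam n > 6 / 5 - c / tri n) (19 / 175)"
  proof (rule best_possibleI[of _ _ "\<lambda>n. tri n * (6 / 5 - Lam n)"])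
    have "(\<lambda>n. 19 / 175 - 13 / 250 * u n + \<delta> n * u n ^ 2) \<longlonglongrightarrow> 19 / 175 - 13 / 250 * 0 + C * 0 ^ 2"
      by (intro tendsto_intros u_lim \<delta>_lim)
    moreover have "\<forall>\<^sub>F n in sequentially. 19 / 175 - 13 / 250 * u n + \<delta> n * u n ^ 2 = tri n * (6 / 5 - Lam n)"
      using ev
    proof eventually_elim
      case (elim n)
      then show ?case
        using u(1)[OF elim] by (simp add: Lam u(3) field_simps power2_eq_square power3_eq_cube)
    qed
    ultimately show "(\<lambda>n. tri n * (6 / 5 - Lam n)) \<longlonglongrightarrow> 19 / 175"
      by (auto intro: Lim_transform_eventually)
    show "\<forall>n\<ge>1. Lam n > 6 / 5 - 19 / 175 / tri n"
    proof (intro allI impI)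
      fix n :: nat assume n: "n \<ge> 1"
      \<comment> \<open>As \<open>C < 13 / 250\<close>, the remainder is smaller than the quadratic
        term.\<close>
      have "\<delta> n * u n ^ 3 < C * u n ^ 3" using \<delta>[OF n] u[OF n] by simp
      also have "\<dots> \<le> C * (u n * u n)" using u_power(2)[OF n] by (simp add: C_def)
      also have "\<dots> < 13 / 250 * (u n * u n)" using u(1)[OF n] by (simp add: C_def)
      finally show "Lam n > 6 / 5 - 19 / 175 / tri n"
        by (simp add: Lam[OF n] u(3)[OF n] power2_eq_square)
    qed
    show "tri n * (6 / 5 - Lam n) < c'" if "\<forall>n\<ge>1. Lam n > 6 / 5 - c' / tri n" "n \<ge> 1" for c' n
    proof -
      have "6 / 5 - Lam n < c' / tri n" using that(1)[rule_format, OF that(2)] by simp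
      then show ?thesis using tri_ge_1[OF that(2)] by (simp add: field_simps)
    qed
  qed
  have 6: "best_possible (\<lambda>c. \<forall>n\<ge>1. Lam n < 6 / 5 - 19 / (175 * tri n) + c / tri n ^ 2) (13 / 250)"
  proof (rule best_possibleI[of _ _ "\<lambda>n. tri n ^ 2 * (Lam n - 6 / 5 + 19 / (175 * tri n))"])
    have "(\<lambda>n. 13 / 250 - \<delta> n * u n) \<longlonglongrightarrow> 13 / 250 - C * 0"
      by (intro tendsto_intros u_lim \<delta>_lim)
    moreover have "\<forall>\<^sub>F n in sequentially.
        13 / 250 - \<delta> n * u n = tri n ^ 2 * (Lam n - 6 / 5 + 19 / (175 * tri n))"
      using ev
    proof eventually_elim
      case (elim n)
      then show ?case
        using u(1)[OF elim] by (simp add: Lam u(3) field_simps power2_eq_square power3_eq_cube)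
    qed
    ultimately show "(\<lambda>n. tri n ^ 2 * (Lam n - 6 / 5 + 19 / (175 * tri n))) \<longlonglongrightarrow> 13 / 250"
      by (auto intro: Lim_transform_eventually)
    show "\<forall>n\<ge>1. Lam n < 6 / 5 - 19 / (175 * tri n) + 13 / 250 / tri n ^ 2"
      using Lam_bounds(2) by (simp add: Lam_approx_def)
    show "tri n ^ 2 * (Lam n - 6 / 5 + 19 / (175 * tri n)) < c'"
      if "\<forall>n\<ge>1. Lam n < 6 / 5 - 19 / (175 * tri n) + c' / tri n ^ 2" "n \<ge> 1" for c' n
    proof -
      have "Lam n - 6 / 5 + 19 / (175 * tri n) < c' / tri n ^ 2"
        using that(1)[rule_format, OF that(2)] by simp
      then show ?thesis
        using tri_ge_1[OF that(2)] by (simp add: pos_less_divide_eq mult.commute)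
    qed
  qed
  have 7: "a = 6 / 5 \<and> b = 19 / 175 \<and> c = 13 / 250"
    if bigo: "(\<lambda>n. Lam n - (a - b / tri n + c / tri n ^ 2)) \<in> O(\<lambda>n. 1 / tri n ^ 3)" for a b c :: real
  proof -
    \<comment> \<open>Convergence of \<delta> puts the remainder into \<open>O(u ^ 3)\<close>. Any
      competing expansion therefore differs from the true one by a quadratic polynomial in
      \<open>u\<close> of that order, whose coefficients must vanish.\<close>
    have "\<delta> \<in> O(\<lambda>_. 1)"
      by (rule bigoI_tendsto[where c = C]) (use \<delta>_lim in auto)
    then have "(\<lambda>n. \<delta> n * u n ^ 3) \<in> O(\<lambda>n. u n ^ 3)"
      using landau_o.big.mult[of \<delta> _ "\<lambda>_. 1" "\<lambda>n. u n ^ 3" "\<lambda>n. u n ^ 3"] by simp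
    moreover have "(\<lambda>n. Lam n - (a - b / tri n + c / tri n ^ 2)) \<in> O(\<lambda>n. u n ^ 3)"
      using bigo by (simp add: u_def power_one_over inverse_eq_divide)
    ultimately have "(\<lambda>n. Lam n - (a - b / tri n + c / tri n ^ 2) + \<delta> n * u n ^ 3) \<in> O(\<lambda>n. u n ^ 3)"
      by (intro sum_in_bigo(1))
    moreover have "\<forall>\<^sub>F n in sequentially. Lam n - (a - b / tri n + c / tri n ^ 2) + \<delta> n * u n ^ 3 =
        (6 / 5 - a) + (b - 19 / 175) * u n + (13 / 250 - c) * u n ^ 2"
      using ev by eventually_elim (simp add: Lam u(3) power_divide algebra_simps)
    ultimately have "(\<lambda>n. (6 / 5 - a) + (b - 19 / 175) * u n + (13 / 250 - c) * u n ^ 2) \<in> O(\<lambda>n. u n ^ 3)"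
      by (simp add: landau_o.big.in_cong)
    from expansion_coeffs_zero[OF u_lim eventually_mono[OF ev u(1)] this] show ?thesis
      by simp
  qed
  show ?thesis
    using 1 2 3 4 5 6 7 by blast
qed

end
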